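(* Let $T$ be a $d$-regular rooted tree, let $\mathcal{P},\mathcal{Q}\le\mathrm{Aut}(T^D)$ be minimal pattern subgroups of depth $D$ and let $\Gamma_{\mathcal{P}\mathcal{Q}}$ be their associated directed graph. (i) If $\Gamma_{\mathcal{P}\mathcal{Q}}$ has a cycle, then $G_{\mathcal{P}}$ and $G_{\mathcal{Q}}$ are conjugate in $\mathrm{Aut}(T)$. (ii) If $G_{\mathcal{P}}$ is fractal, then $G_{\mathcal{P}}$ and $G_{\mathcal{Q}}$ are conjugate in $\mathrm{Aut}(T)$ if and only if $\Gamma_{\mathcal{P}\mathcal{Q}}$ has a cycle.
   Context: $T$ is the $d$-regular rooted tree ($d\ge2$) with vertices the finite words over $\{1,\dots,d\}$, $\mathcal{L}_n$ its $n$-th level, $T^n$ the truncation to levels $0,\dots,n$. $\mathrm{Aut}(T)$ is the group of root- and adjacency-preserving bijections of $T$, acting on the left; $\pi_n$ denotes restriction of the action to $T^n$ (on $\mathrm{Aut}(T)$ or on $\mathrm{Aut}(T^m)$, $m\ge n$). For $g\in\mathrm{Aut}(T)$ and a vertex $v$, the section $g|_v\in \mathrm{Aut}(T)$ is defined by $g(vw)=g(v)\,g|_v(w)$, and $g|_v^n:=\pi_n(g|_v)$. Similarly, for $r\in\mathrm{Aut}(T^D)$ and $x\in\mathcal{L}_1$, $r|_x\in\mathrm{Aut}(T^{D-1})$ is the section of $r$ at $x$. For $\mathcal{P}\le\mathrm{Aut}(T^D)$, the group of finite type of depth $D$ is $G_{\mathcal{P}}=\{g\in\mathrm{Aut}(T):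 g|_v^D\in\mathcal{P}\text{ for all vertices }v\}$. $\mathcal{P}$ is a minimal pattern subgroup if $\pi_D(G_{\mathcal{P}})=\mathcal{P}$. Graph $\Gamma_{\mathcal{P}\mathcal{Q}}$: let $\mathcal{S}_{\mathcal{P}\mathcal{Q}}=\{r\in\mathrm{Aut}(T^D): r\mathcal{P}r^{-1}=\mathcal{Q}\}$, with the equivalence relation $r\sim r'$ iff $r r'^{-1}\in\mathcal{Q}$. For $r,r'\in\mathcal{S}_{\mathcal{P}\mathcal{Q}}$ and $x\in\mathcal{L}_1$ write $r\xrightarrow{x}r'$ if $r|_x=\pi_{D-1}(r')$. The vertices of $\Gamma_{\mathcal{P}\mathcal{Q}}$ are the classes in $\mathcal{S}_{\mathcal{P}\mathcal{Q}}/\!\sim$, and there is an edge $C\to C'$ iff for every $r\in C$ there exist $r_1,\dots,r_d\in C'$ with $r\xrightarrow{x}r_x$ for all $x\in\mathcal{L}_1$. Cycles are directed cycles (loops included). A group $G\le\mathrm{Aut}(T)$ is self-similar if $g|_v\in G$ for all $g\in G$ and all vertices $v$; level-transitive if transitive on every $\mathcal{L}_n$; fractal if it is self-similar, level-transitive and $\{g|_v: g\in G,\ g(v)=v\}=G$ for every vertex $v$. *)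

theory Defs
  imports "HOL-Algebra.Bij" "HOL-Algebra.Coset" "Graph_Theory.Arc_Walk"
begin

definition tree :: "nat \<Rightarrow> nat list set" where
  "tree d = lists {1..d}"

definition tree_level :: "nat \<Rightarrow> nat \<Rightarrow> nat list set" where
  "tree_level d n = {v \<in> tree d. length v = n}"

definition trunc_tree :: "nat \<Rightarrow> nat \<Rightarrow> nat list set" where
  "trunc_tree d n = {v \<in> tree d. length v \<le> n}"

definition tree_adj :: "nat list \<Rightarrow> nat list \<Rightarrow> bool" where
  "tree_adj v w \<longleftrightarrow> (\<exists>x. w = v @ [x] \<or> v = w @ [x])"

text \<open>The argument \<open>A\<close> is the vertex set, either \<open>tree d\<close> or \<open>trunc_tree d n\<close>. The group is
  a subgroup of \<^const>\<open>BijGroup\<close>: its elements are extensional functions on \<open>A\<close>, and the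
  product of \<open>g\<close> and \<open>h\<close> is \<open>g \<circ> h\<close> (left action).\<close>

definition tree_Aut :: "nat list set \<Rightarrow> (nat list \<Rightarrow> nat list) monoid" where
  "tree_Aut A = (BijGroup A)
     \<lparr>carrier := {g \<in> Bij A. g [] = [] \<and>
        (\<forall>v\<in>A. \<forall>w\<in>A. tree_adj v w \<longleftrightarrow> tree_adj (g v) (g w))}\<rparr>"

abbreviation Aut_T :: "nat \<Rightarrow> (nat list \<Rightarrow> nat list) monoid" where
  "Aut_T d \<equiv> tree_Aut (tree d)"

abbreviation Aut_Tn :: "nat \<Rightarrow> nat \<Rightarrow> (nat list \<Rightarrow> nat list) monoid" where
  "Aut_Tn d n \<equiv> tree_Aut (trunc_tree d n)"

text \<open>The map \<open>\<pi>\<^sub>n\<close>, both on \<open>Aut_T d\<close> and on \<open>Aut_Tn d m\<close> for \<open>m \<ge> n\<close>.\<close>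

definition tree_proj :: "nat \<Rightarrow> nat \<Rightarrow> (nat list \<Rightarrow> nat list) \<Rightarrow> (nat list \<Rightarrow> nat list)" where
  "tree_proj d n g = restrict g (trunc_tree d n)"

text \<open>The section at \<open>v\<close> of an automorphism \<open>g\<close> of the tree with vertex set \<open>A\<close>: it is defined on
  the words \<open>w\<close> with \<open>v @ w \<in> A\<close>, that is, on \<open>tree d\<close> if \<open>A = tree d\<close>, and on
  \<open>trunc_tree d (n - 1)\<close> if \<open>A = trunc_tree d n\<close>, \<open>n \<ge> 1\<close> and \<open>v\<close> has length 1. The defining
  equation is lemma \<open>tree_section_eq\<close> below.\<close>

definition tree_section ::
    "nat list set \<Rightarrow> (nat list \<Rightarrow> nat list) \<Rightarrow> nat list \<Rightarrow> (nat list \<Rightarrow> nat list)" where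
  "tree_section A g v = (\<lambda>w\<in>{w. v @ w \<in> A}. drop (length (g v)) (g (v @ w)))"

definition finite_type_group ::
    "nat \<Rightarrow> nat \<Rightarrow> (nat list \<Rightarrow> nat list) set \<Rightarrow> (nat list \<Rightarrow> nat list) set" where
  "finite_type_group d D P =
     {g \<in> carrier (Aut_T d). \<forall>v\<in>tree d. tree_proj d D (tree_section (tree d) g v) \<in> P}"

definition minimal_pattern_subgroup ::
    "nat \<Rightarrow> nat \<Rightarrow> (nat list \<Rightarrow> nat list) set \<Rightarrow> bool" where
  "minimal_pattern_subgroup d D P \<longleftrightarrow>
     subgroup P (Aut_Tn d D) \<and> tree_proj d D ` finite_type_group d D P = P"

definition conjugate_in :: "('a, 'b) monoid_scheme \<Rightarrow> 'a set \<Rightarrow> 'a set \<Rightarrow> bool" where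
  "conjugate_in M H K \<longleftrightarrow> (\<exists>h\<in>carrier M. h <#\<^bsub>M\<^esub> H #>\<^bsub>M\<^esub> inv\<^bsub>M\<^esub> h = K)"

definition conjugators ::
    "nat \<Rightarrow> nat \<Rightarrow> (nat list \<Rightarrow> nat list) set \<Rightarrow> (nat list \<Rightarrow> nat list) set
      \<Rightarrow> (nat list \<Rightarrow> nat list) set" where
  "conjugators d D P Q =
     {r \<in> carrier (Aut_Tn d D).
        r <#\<^bsub>Aut_Tn d D\<^esub> P #>\<^bsub>Aut_Tn d D\<^esub> inv\<^bsub>Aut_Tn d D\<^esub> r = Q}"

definition conjugator_rel ::
    "nat \<Rightarrow> nat \<Rightarrow> (nat list \<Rightarrow> nat list) set \<Rightarrow> (nat list \<Rightarrow> nat list) set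
      \<Rightarrow> (nat list \<Rightarrow> nat list) rel" where
  "conjugator_rel d D P Q =
     {(r, r'). r \<in> conjugators d D P Q \<and> r' \<in> conjugators d D P Q \<and>
        r \<otimes>\<^bsub>Aut_Tn d D\<^esub> inv\<^bsub>Aut_Tn d D\<^esub> r' \<in> Q}"

definition section_arrow ::
    "nat \<Rightarrow> nat \<Rightarrow> (nat list \<Rightarrow> nat list) \<Rightarrow> nat list \<Rightarrow> (nat list \<Rightarrow> nat list) \<Rightarrow> bool" where
  "section_arrow d D r x r' \<longleftrightarrow> tree_section (trunc_tree d D) r x = tree_proj d (D - 1) r'"

definition conjugator_graph ::
    "nat \<Rightarrow> nat \<Rightarrow> (nat list \<Rightarrow> nat list) set \<Rightarrow> (nat list \<Rightarrow> nat list) set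
      \<Rightarrow> ((nat list \<Rightarrow> nat list) set,
          (nat list \<Rightarrow> nat list) set \<times> (nat list \<Rightarrow> nat list) set) pre_digraph" where
  "conjugator_graph d D P Q =
     (let V = conjugators d D P Q // conjugator_rel d D P Q in
      \<lparr>verts = V,
       arcs = {(C, C'). C \<in> V \<and> C' \<in> V \<and>
         (\<forall>r\<in>C. \<exists>\<rho>. \<forall>x\<in>tree_level d 1. \<rho> x \<in> C' \<and> section_arrow d D r x (\<rho> x))},
       tail = fst, head = snd\<rparr>)"

text \<open>The library predicate \<^const>\<open>pre_digraph.cycle\<close> describes directed cycles and counts a loop
  as a cycle.\<close>

definition has_cycle :: "('a, 'b) pre_digraph \<Rightarrow> bool" where
  "has_cycle \<Gamma> \<longleftrightarrow> (\<exists>p. pre_digraph.cycle \<Gamma> p)"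

definition self_similar :: "nat \<Rightarrow> (nat list \<Rightarrow> nat list) set \<Rightarrow> bool" where
  "self_similar d G \<longleftrightarrow> (\<forall>g\<in>G. \<forall>v\<in>tree d. tree_section (tree d) g v \<in> G)"

definition level_transitive :: "nat \<Rightarrow> (nat list \<Rightarrow> nat list) set \<Rightarrow> bool" where
  "level_transitive d G \<longleftrightarrow>
     (\<forall>n. \<forall>v\<in>tree_level d n. \<forall>w\<in>tree_level d n. \<exists>g\<in>G. g v = w)"

definition fractal :: "nat \<Rightarrow> (nat list \<Rightarrow> nat list) set \<Rightarrow> bool" where
  "fractal d G \<longleftrightarrow> subgroup G (Aut_T d) \<and> self_similar d G \<and> level_transitive d G \<and>
     (\<forall>v\<in>tree d. {tree_section (tree d) g v | g. g \<in> G \<and> g v = v} = G)"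

lemma subgroup_tree_Aut:
  assumes "[] \<in> A"
  shows "subgroup (carrier (tree_Aut A)) (BijGroup A)"
proof (rule group.subgroupI[OF group_BijGroup])
  show "carrier (tree_Aut A) \<subseteq> carrier (BijGroup A)"
    by (auto simp: tree_Aut_def BijGroup_def)
  have "(\<lambda>x\<in>A. x) \<in> carrier (tree_Aut A)"
    using assms by (auto simp: tree_Aut_def id_Bij)
  then show "carrier (tree_Aut A) \<noteq> {}"
    by blast
next
  fix g assume g: "g \<in> carrier (tree_Aut A)"
  then have gB: "g \<in> Bij A" and g0: "g [] = []"
    and ga: "\<And>v w. v \<in> A \<Longrightarrow> w \<in> A \<Longrightarrow> tree_adj v w \<longleftrightarrow> tree_adj (g v) (g w)"
    by (auto simp: tree_Aut_def)
  have inj: "inj_on g A" and im: "g ` A = A"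
    using gB by (auto simp: Bij_def bij_betw_def)
  have mem: "inv_into A g v \<in> A" "g (inv_into A g v) = v" if "v \<in> A" for v
    using that im by (metis inv_into_into, metis f_inv_into_f)
  have "inv_into A g [] = []"
    using assms g0 inj by (metis inv_into_f_f)
  then have "restrict (inv_into A g) A \<in> carrier (tree_Aut A)"
    using assms mem ga gB by (auto simp: tree_Aut_def restrict_inv_into_Bij)
  then show "inv\<^bsub>BijGroup A\<^esub> g \<in> carrier (tree_Aut A)"
    using gB by (simp add: inv_BijGroup)
next
  fix g h assume gh: "g \<in> carrier (tree_Aut A)" "h \<in> carrier (tree_Aut A)"
  then have B: "g \<in> Bij A" "h \<in> Bij A"
    by (auto simp: tree_Aut_def)
  have "h v \<in> A" if "v \<in> A" for v
    using Bij_imp_funcset[OF B(2)] that by blast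
  with gh assms have "compose A g h \<in> carrier (tree_Aut A)"
    by (simp add: tree_Aut_def compose_Bij compose_eq)
  with B show "g \<otimes>\<^bsub>BijGroup A\<^esub> h \<in> carrier (tree_Aut A)"
    by (simp add: BijGroup_def)
qed

lemma group_tree_Aut:
  assumes "[] \<in> A"
  shows "group (tree_Aut A)"
  using subgroup.subgroup_is_group[OF subgroup_tree_Aut[OF assms] group_BijGroup]
  by (simp add: tree_Aut_def)

lemma tree_Aut_snoc:
  assumes closed: "\<And>v x. v @ [x] \<in> A \<Longrightarrow> v \<in> A"
    and g: "g \<in> carrier (tree_Aut A)" and "v @ [x] \<in> A"
  shows "\<exists>y. g (v @ [x]) = g v @ [y]"
  using assms(3)
proof (induction v arbitrary: x rule: rev_induct)
  case Nil
  have "tree_adj [] [x]"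
    by (simp add: tree_adj_def)
  then have "tree_adj (g []) (g [x])" "g [] = []"
    using g Nil closed[of "[]" x] by (auto simp: tree_Aut_def)
  then show ?case
    by (auto simp: tree_adj_def)
next
  case (snoc z v)
  have m: "v @ [z] \<in> A" "v \<in> A"
    using closed snoc.prems by blast+
  obtain y where y: "g (v @ [z]) = g v @ [y]"
    using snoc.IH m by blast
  have "inj_on g A"
    using g by (auto simp: tree_Aut_def Bij_def bij_betw_def)
  then have "g ((v @ [z]) @ [x]) \<noteq> g v"
    using m snoc.prems by (auto dest: inj_onD)
  moreover have "tree_adj (v @ [z]) ((v @ [z]) @ [x])"
    unfolding tree_adj_def by blast
  then have "tree_adj (g (v @ [z])) (g ((v @ [z]) @ [x]))"
    using g m snoc.prems unfolding tree_Aut_def by auto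
  ultimately show ?case
    using y by (auto simp: tree_adj_def)
qed

lemma tree_section_eq:
  assumes closed: "\<And>v x. v @ [x] \<in> A \<Longrightarrow> v \<in> A"
    and g: "g \<in> carrier (tree_Aut A)" and "v @ w \<in> A"
  shows "g (v @ w) = g v @ tree_section A g v w"
proof -
  have "\<exists>u. g (v @ w) = g v @ u"
    using \<open>v @ w \<in> A\<close>
  proof (induction w rule: rev_induct)
    case (snoc x w)
    have m: "(v @ w) @ [x] \<in> A"
      using snoc.prems by simp
    have "\<exists>y. g ((v @ w) @ [x]) = g (v @ w) @ [y]"
      by (rule tree_Aut_snoc[OF _ g m]) (rule closed)
    moreover have "v @ w \<in> A"
      using m by (rule closed)
    ultimately show ?case
      using snoc.IH by force
  qed simp
  then show ?thesis
    using \<open>v @ w \<in> A\<close> by (auto simp: tree_section_def)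
qed

end

theory Submission
  imports Defs
begin

text \<open>A cycle unrolls to an infinite walk \<open>C\<^sub>0, C\<^sub>1, \<dots>\<close>. Choosing \<open>r\<^sub>v \<in> C\<^sub>n\<close> for every \<open>v\<close> of length
  \<open>n\<close>, compatibly with the arrows, gives local data that glue to some \<open>h\<close> with truncated
  sections \<open>r\<^sub>v\<close>. Since \<open>r\<^sub>u \<sim> r\<^sub>v\<close> on each level, the section
  \<open>h|\<^sub>g\<^sub>u g|\<^sub>u (h|\<^sub>u)\<inverse>\<close> of \<open>h g h\<inverse>\<close> at \<open>h u\<close> has its truncation in \<open>Q\<close> iff that of \<open>g|\<^sub>u\<close> is in
  \<open>P\<close>, so \<open>h\<close> conjugates \<open>G\<^sub>P\<close> to \<open>G\<^sub>Q\<close>.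

  Conversely let \<open>h\<close> conjugate a fractal \<open>G\<^sub>P\<close> to \<open>G\<^sub>Q\<close> and let \<open>r\<^sub>v\<close> be the truncation of \<open>h|\<^sub>v\<close>.
  Lifting elements of \<open>G\<^sub>P\<close> to stabilisers of \<open>v\<close> gives \<open>r\<^sub>v P r\<^sub>v\<inverse> \<subseteq> Q\<close>, with equality because \<open>P\<close>
  and \<open>Q\<close> are finite and already conjugate by the truncation of \<open>h\<close>. Level-transitivity puts all
  \<open>r\<^sub>v\<close> of one level into one class, and these classes form an infinite walk in a finite graph.\<close>

section \<open>Automorphisms, sections and truncations\<close>

lemma Nil_in_tree [simp]: "[] \<in> tree d"
  by (simp add: tree_def)

lemma append_in_tree [simp]: "v @ w \<in> tree d \<longleftrightarrow> v \<in> tree d \<and> w \<in> tree d"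
  by (auto simp: tree_def)

lemma Cons_in_tree [simp]: "x # w \<in> tree d \<longleftrightarrow> x \<in> {1..d} \<and> w \<in> tree d"
  by (auto simp: tree_def)

lemma Nil_in_trunc_tree [simp]: "[] \<in> trunc_tree d n"
  by (simp add: trunc_tree_def)

lemma trunc_tree_subset: "v \<in> trunc_tree d n \<Longrightarrow> v \<in> tree d"
  by (simp add: trunc_tree_def)

lemma finite_trunc_tree: "finite (trunc_tree d n)"
proof -
  have "trunc_tree d n = {v. set v \<subseteq> {1..d} \<and> length v \<le> n}"
    by (auto simp: trunc_tree_def tree_def in_lists_conv_set)
  then show ?thesis
    by (simp add: finite_lists_length_le)
qed

lemma group_Aut_T: "group (Aut_T d)"
  by (rule group_tree_Aut) simp

lemma group_Aut_Tn: "group (Aut_Tn d n)"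
  by (rule group_tree_Aut) simp

text \<open>Finiteness enters twice: in the comparison of the cardinalities of \<open>P\<close> and
  \<open>Q\<close>, and in the pigeonhole argument on the vertices of the graph.\<close>

lemma finite_Aut_Tn: "finite (carrier (Aut_Tn d n))"
proof (rule finite_subset)
  show "carrier (Aut_Tn d n) \<subseteq> trunc_tree d n \<rightarrow>\<^sub>E trunc_tree d n"
    by (auto simp: tree_Aut_def Bij_def PiE_def bij_betw_def)
  show "finite (trunc_tree d n \<rightarrow>\<^sub>E trunc_tree d n)"
    by (intro finite_PiE finite_trunc_tree)
qed

text \<open>The common feature of the full tree and its truncations, so that facts about their
  automorphisms can be proved once for both.\<close>

definition prefix_closed :: "nat list set \<Rightarrow> bool" where
  "prefix_closed A \<longleftrightarrow> [] \<in> A \<and> (\<forall>v x. v @ [x] \<in> A \<longrightarrow> v \<in> A)"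

lemma prefix_closed_tree [simp]: "prefix_closed (tree d)"
  by (simp add: prefix_closed_def)

lemma prefix_closed_trunc_tree [simp]: "prefix_closed (trunc_tree d n)"
  by (simp add: prefix_closed_def trunc_tree_def)

lemma prefix_closed_butlast: "prefix_closed A \<Longrightarrow> v \<in> A \<Longrightarrow> butlast v \<in> A"
  by (cases v rule: rev_cases) (auto simp: prefix_closed_def)

lemma tree_adj_iff:
  "tree_adj v w \<longleftrightarrow> (w \<noteq> [] \<and> v = butlast w) \<or> (v \<noteq> [] \<and> w = butlast v)"
  unfolding tree_adj_def by (metis butlast_snoc snoc_eq_iff_butlast)

text \<open>Adjacency is the parent relation \<open>butlast\<close> read in either direction. An
  automorphism fixing the root sends children to children of the image, so levels and parents
  persist by induction along the word; conversely, injectivity reflects the parent relation.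
  Sections, truncations and glued maps are shown to be automorphisms through this criterion.\<close>

lemma tree_Aut_iff:
  assumes A: "prefix_closed A"
  shows "g \<in> carrier (tree_Aut A) \<longleftrightarrow>
    g \<in> Bij A \<and> (\<forall>v\<in>A. length (g v) = length v \<and> g (butlast v) = butlast (g v))"
    (is "_ \<longleftrightarrow> _ \<and> ?pres")
proof
  assume g: "g \<in> carrier (tree_Aut A)"
  have extends: "\<exists>y. g (v @ [x]) = g v @ [y]" if "v @ [x] \<in> A" for v x
    by (rule tree_Aut_snoc[OF _ g that]) (use A in \<open>auto simp: prefix_closed_def\<close>)
  have "length (g v) = length v \<and> g (butlast v) = butlast (g v)" if "v \<in> A" for v
    using that
  proof (induction v rule: rev_induct)
    case Nil
    then show ?case
      using g by (simp add: tree_Aut_def)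
  next
    case (snoc x v)
    then have "v \<in> A"
      using A by (auto simp: prefix_closed_def)
    with snoc show ?case
      using extends[of v x] by auto
  qed
  then show "g \<in> Bij A \<and> ?pres"
    using g by (auto simp: tree_Aut_def)
next
  assume g: "g \<in> Bij A \<and> ?pres"
  have ne: "g v = [] \<longleftrightarrow> v = []" if "v \<in> A" for v
    using g that by (metis length_0_conv)
  have inj: "g v = g w \<longleftrightarrow> v = w" if "v \<in> A" "w \<in> A" for v w
    using g that by (auto simp: Bij_def bij_betw_def inj_on_eq_iff)
  have bl: "g v = butlast (g w) \<longleftrightarrow> v = butlast w" if "v \<in> A" "w \<in> A" for v w
    using g that inj prefix_closed_butlast[OF A] by metis
  show "g \<in> carrier (tree_Aut A)"
    using g A by (auto simp: tree_Aut_def tree_adj_iff ne bl prefix_closed_def)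
qed

lemma tree_Aut_length:
  "prefix_closed A \<Longrightarrow> g \<in> carrier (tree_Aut A) \<Longrightarrow> v \<in> A \<Longrightarrow> length (g v) = length v"
  by (simp add: tree_Aut_iff)

lemma tree_Aut_in: "g \<in> carrier (tree_Aut A) \<Longrightarrow> v \<in> A \<Longrightarrow> g v \<in> A"
  by (auto simp: tree_Aut_def dest: Bij_imp_funcset)

lemma tree_Aut_ext:
  assumes "g \<in> carrier (tree_Aut A)" "h \<in> carrier (tree_Aut A)" "\<And>v. v \<in> A \<Longrightarrow> g v = h v"
  shows "g = h"
  using assms by (intro extensionalityI[of g A h]) (auto simp: tree_Aut_def Bij_def)

lemma tree_Aut_mult_apply:
  assumes "g \<in> carrier (tree_Aut A)" "h \<in> carrier (tree_Aut A)" "v \<in> A"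
  shows "(g \<otimes>\<^bsub>tree_Aut A\<^esub> h) v = g (h v)"
  using assms by (simp add: tree_Aut_def BijGroup_def compose_def)

lemma tree_Aut_one_apply: "v \<in> A \<Longrightarrow> \<one>\<^bsub>tree_Aut A\<^esub> v = v"
  by (simp add: tree_Aut_def BijGroup_def)

lemma tree_Aut_inv_apply:
  assumes "[] \<in> A" "g \<in> carrier (tree_Aut A)" "v \<in> A"
  shows "(inv\<^bsub>tree_Aut A\<^esub> g) (g v) = v" "g ((inv\<^bsub>tree_Aut A\<^esub> g) v) = v"
proof -
  interpret group "tree_Aut A"
    using assms(1) by (rule group_tree_Aut)
  show "(inv\<^bsub>tree_Aut A\<^esub> g) (g v) = v"
    using assms tree_Aut_mult_apply[of "inv\<^bsub>tree_Aut A\<^esub> g" A g v] by (simp add: tree_Aut_one_apply)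
  show "g ((inv\<^bsub>tree_Aut A\<^esub> g) v) = v"
    using assms tree_Aut_mult_apply[of g A "inv\<^bsub>tree_Aut A\<^esub> g" v] by (simp add: tree_Aut_one_apply)
qed

lemma tree_Aut_append:
  assumes "prefix_closed A" "g \<in> carrier (tree_Aut A)" "v @ w \<in> A"
  shows "g (v @ w) = g v @ tree_section A g v w"
  by (rule tree_section_eq[OF _ assms(2,3)]) (use assms(1) in \<open>auto simp: prefix_closed_def\<close>)

section \<open>Calculus of sections\<close>

abbreviation sect :: "nat \<Rightarrow> (nat list \<Rightarrow> nat list) \<Rightarrow> nat list \<Rightarrow> nat list \<Rightarrow> nat list" where
  "sect d \<equiv> tree_section (tree d)"

lemma Aut_T_append:
  assumes "g \<in> carrier (Aut_T d)" "v \<in> tree d" "w \<in> tree d"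
  shows "g (v @ w) = g v @ sect d g v w"
  using assms by (intro tree_Aut_append) auto

text \<open>An automorphism carries the subtree below \<open>v\<close> bijectively onto the subtree
  below \<open>g v\<close>; every required property transfers by cancelling the common prefix
  \<open>g v\<close>.\<close>

lemma sect_in_Aut:
  assumes g: "g \<in> carrier (Aut_T d)" and v: "v \<in> tree d"
  shows "sect d g v \<in> carrier (Aut_T d)"
proof -
  have app: "g (v @ w) = g v @ sect d g v w" if "w \<in> tree d" for w
    using Aut_T_append[OF g v that] .
  have gv: "g v \<in> tree d" "length (g v) = length v"
    using g v by (auto intro: tree_Aut_in tree_Aut_length[OF prefix_closed_tree])
  have inj: "inj_on g (tree d)" and im: "g ` tree d = tree d"
    using g by (auto simp: tree_Aut_def Bij_def bij_betw_def)
  have mem: "sect d g v w \<in> tree d" if "w \<in> tree d" for w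
    using app[OF that] tree_Aut_in[OF g, of "v @ w"] v that by simp
  have len: "length (sect d g v w) = length w" if "w \<in> tree d" for w
    using app[OF that] tree_Aut_length[OF prefix_closed_tree g, of "v @ w"] v that gv by simp
  have "sect d g v \<in> Bij (tree d)"
  proof -
    have "sect d g v \<in> extensional (tree d)"
      using v by (simp add: tree_section_def)
    moreover have "inj_on (sect d g v) (tree d)"
    proof (rule inj_onI)
      fix w w' assume w: "w \<in> tree d" "w' \<in> tree d" "sect d g v w = sect d g v w'"
      then have "g (v @ w) = g (v @ w')"
        by (simp add: app)
      then show "w = w'"
        using inj w v by (auto dest: inj_onD)
    qed
    moreover have "u \<in> sect d g v ` tree d" if u: "u \<in> tree d" for u
    proof -
      have "g v @ u \<in> g ` tree d"
        using im gv u by simp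
      then obtain z where z: "z \<in> tree d" "g z = g v @ u"
        by force
      \<comment> \<open>A preimage \<open>z\<close> of \<open>g v @ u\<close> is cut at the level of
        \<open>v\<close>. As levels are preserved, its first part has image exactly
        \<open>g v\<close>, hence equals \<open>v\<close>.\<close>
      define a b where "a = take (length v) z" and "b = drop (length v) z"
      have ab: "z = a @ b" "a \<in> tree d" "b \<in> tree d"
        using z(1) append_in_tree[of a b d] by (auto simp: a_def b_def)
      have "length (g z) = length z"
        by (rule tree_Aut_length[OF prefix_closed_tree g z(1)])
      then have "length a = length v"
        using z(2) gv by (simp add: a_def)
      then have "length (g a) = length v"
        using tree_Aut_length[OF prefix_closed_tree g ab(2)] by simp
      then have "g a = g v" "sect d g a b = u"
        using z(2) ab gv Aut_T_append[OF g ab(2,3)] by auto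
      then have "a = v"
        using inj ab v by (auto dest: inj_onD)
      then show ?thesis
        using ab \<open>sect d g a b = u\<close> by blast
    qed
    ultimately show ?thesis
      using mem by (auto simp: Bij_def bij_betw_def)
  qed
  moreover have "sect d g v (butlast w) = butlast (sect d g v w)" if w: "w \<in> tree d" for w
  \<comment> \<open>The empty word is treated apart, since there \<open>butlast\<close> applied to
    \<open>v @ w\<close> could cut into \<open>v\<close>.\<close>
  proof (cases "w = []")
    case True
    then show ?thesis
      using len[of "[]"] by simp
  next
    case False
    have bw: "butlast w \<in> tree d"
      using w prefix_closed_butlast prefix_closed_tree by blast
    have "g v @ sect d g v (butlast w) = g (butlast (v @ w))"
      using app[OF bw] False by (simp add: butlast_append)
    also have "\<dots> = butlast (g (v @ w))"
      using g v w by (simp add: tree_Aut_iff)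
    also have "\<dots> = g v @ butlast (sect d g v w)"
      using app[OF w] False len[OF w] by (auto simp: butlast_append)
    finally show ?thesis
      by simp
  qed
  ultimately show ?thesis
    using len by (simp add: tree_Aut_iff)
qed

lemma sect_sect:
  assumes "g \<in> carrier (Aut_T d)" "v \<in> tree d" "w \<in> tree d"
  shows "sect d (sect d g v) w = sect d g (v @ w)"
proof (rule tree_Aut_ext)
  show "sect d (sect d g v) w \<in> carrier (Aut_T d)" "sect d g (v @ w) \<in> carrier (Aut_T d)"
    using assms by (simp_all add: sect_in_Aut)
  fix u assume u: "u \<in> tree d"
  have "g (v @ w @ u) = g v @ sect d g v w @ sect d (sect d g v) w u"
    using assms u by (simp add: Aut_T_append sect_in_Aut)
  moreover have "g ((v @ w) @ u) = g v @ sect d g v w @ sect d g (v @ w) u"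
    using Aut_T_append[of g d "v @ w" u] assms u by (simp add: Aut_T_append)
  ultimately show "sect d (sect d g v) w u = sect d g (v @ w) u"
    by simp
qed

lemma sect_Nil:
  assumes "g \<in> carrier (Aut_T d)"
  shows "sect d g [] = g"
proof (rule tree_Aut_ext)
  show "sect d g [] \<in> carrier (Aut_T d)"
    using assms by (simp add: sect_in_Aut)
  have "g [] = []"
    using assms by (simp add: tree_Aut_def)
  then show "sect d g [] u = g u" if "u \<in> tree d" for u
    using Aut_T_append[OF assms _ that, of "[]"] by simp
qed (fact assms)

lemma sect_mult:
  assumes g: "g \<in> carrier (Aut_T d)" and h: "h \<in> carrier (Aut_T d)" and v: "v \<in> tree d"
  shows "sect d (g \<otimes>\<^bsub>Aut_T d\<^esub> h) v = sect d g (h v) \<otimes>\<^bsub>Aut_T d\<^esub> sect d h v"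
proof (rule tree_Aut_ext)
  interpret group "Aut_T d" by (rule group_Aut_T)
  have hv: "h v \<in> tree d"
    using h v by (rule tree_Aut_in)
  have gh: "g \<otimes>\<^bsub>Aut_T d\<^esub> h \<in> carrier (Aut_T d)"
    using g h by simp
  show "sect d (g \<otimes>\<^bsub>Aut_T d\<^esub> h) v \<in> carrier (Aut_T d)"
    using gh v by (rule sect_in_Aut)
  show "sect d g (h v) \<otimes>\<^bsub>Aut_T d\<^esub> sect d h v \<in> carrier (Aut_T d)"
    using g h v hv by (simp add: sect_in_Aut)
  fix u assume u: "u \<in> tree d"
  have hu: "sect d h v u \<in> tree d"
    using sect_in_Aut[OF h v] u by (rule tree_Aut_in)
  have "g (h v) @ sect d (g \<otimes>\<^bsub>Aut_T d\<^esub> h) v u = (g \<otimes>\<^bsub>Aut_T d\<^esub> h) (v @ u)"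
    using Aut_T_append[OF gh v u] g h v by (simp add: tree_Aut_mult_apply)
  also have "\<dots> = g (h v @ sect d h v u)"
    using g h v u by (simp add: tree_Aut_mult_apply Aut_T_append)
  also have "\<dots> = g (h v) @ sect d g (h v) (sect d h v u)"
    using Aut_T_append[OF g hv hu] .
  finally show "sect d (g \<otimes>\<^bsub>Aut_T d\<^esub> h) v u = (sect d g (h v) \<otimes>\<^bsub>Aut_T d\<^esub> sect d h v) u"
    using g h v u hv by (simp add: tree_Aut_mult_apply sect_in_Aut)
qed

text \<open>The identity has trivial sections, so the product rule for \<open>inv h\<close> and
  \<open>h\<close> makes the left side a left inverse of \<open>sect d h v\<close>.\<close>

lemma sect_inv:
  assumes h: "h \<in> carrier (Aut_T d)" and v: "v \<in> tree d"
  shows "sect d (inv\<^bsub>Aut_T d\<^esub> h) (h v) = inv\<^bsub>Aut_T d\<^esub> (sect d h v)"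
proof -
  interpret group "Aut_T d" by (rule group_Aut_T)
  have hv: "h v \<in> tree d"
    using h v by (rule tree_Aut_in)
  have "sect d \<one>\<^bsub>Aut_T d\<^esub> v = \<one>\<^bsub>Aut_T d\<^esub>"
    using v Aut_T_append[of "\<one>\<^bsub>Aut_T d\<^esub>" d v]
    by (intro tree_Aut_ext) (auto simp: sect_in_Aut tree_Aut_one_apply)
  then have "sect d (inv\<^bsub>Aut_T d\<^esub> h) (h v) \<otimes>\<^bsub>Aut_T d\<^esub> sect d h v = \<one>\<^bsub>Aut_T d\<^esub>"
    using h v sect_mult[of "inv\<^bsub>Aut_T d\<^esub> h" d h v] by simp
  then show ?thesis
    using h v hv by (intro inv_equality[symmetric]) (auto simp: sect_in_Aut)
qed

section \<open>Truncation as a homomorphism\<close>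

lemma tree_proj_apply: "v \<in> trunc_tree d n \<Longrightarrow> tree_proj d n g v = g v"
  by (simp add: tree_proj_def)

lemma tree_proj_in_Aut:
  assumes g: "g \<in> carrier (Aut_T d)"
  shows "tree_proj d n g \<in> carrier (Aut_Tn d n)"
proof -
  have len: "length (g v) = length v" if "v \<in> tree d" for v
    using that by (rule tree_Aut_length[OF prefix_closed_tree g])
  have inj: "inj_on g (tree d)" and im: "g ` tree d = tree d"
    using g by (auto simp: tree_Aut_def Bij_def bij_betw_def)
  have "g ` trunc_tree d n = trunc_tree d n"
  proof
    show "g ` trunc_tree d n \<subseteq> trunc_tree d n"
      using len tree_Aut_in[OF g] by (auto simp: trunc_tree_def)
    show "trunc_tree d n \<subseteq> g ` trunc_tree d n"
    proof
      fix v assume v: "v \<in> trunc_tree d n"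
      then have "v \<in> g ` tree d"
        using im by (simp add: trunc_tree_subset)
      then obtain u where u: "u \<in> tree d" "v = g u"
        by blast
      then have "u \<in> trunc_tree d n"
        using v len[OF u(1)] by (simp add: trunc_tree_def)
      with u show "v \<in> g ` trunc_tree d n"
        by blast
    qed
  qed
  moreover have "inj_on g (trunc_tree d n)"
    using inj by (rule inj_on_subset) (auto simp: trunc_tree_def)
  ultimately have "tree_proj d n g \<in> Bij (trunc_tree d n)"
    by (auto simp: Bij_def tree_proj_def bij_betw_def inj_on_restrict_eq)
  moreover have "g (butlast v) = butlast (g v)" if "v \<in> tree d" for v
    using g that by (simp add: tree_Aut_iff)
  ultimately show ?thesis
    using len prefix_closed_butlast[OF prefix_closed_trunc_tree, of _ d n]
    by (auto simp: tree_Aut_iff tree_proj_def trunc_tree_subset)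
qed

lemma tree_proj_hom: "tree_proj d n \<in> hom (Aut_T d) (Aut_Tn d n)"
proof (rule homI)
  interpret T: group "Aut_T d" by (rule group_Aut_T)
  interpret Tn: group "Aut_Tn d n" by (rule group_Aut_Tn)
  show pin: "tree_proj d n g \<in> carrier (Aut_Tn d n)" if "g \<in> carrier (Aut_T d)" for g
    using that by (rule tree_proj_in_Aut)
  fix g h assume gh: "g \<in> carrier (Aut_T d)" "h \<in> carrier (Aut_T d)"
  show "tree_proj d n (g \<otimes>\<^bsub>Aut_T d\<^esub> h) =
      tree_proj d n g \<otimes>\<^bsub>Aut_Tn d n\<^esub> tree_proj d n h"
  proof (rule tree_Aut_ext)
    fix v assume v: "v \<in> trunc_tree d n"
    have "h v \<in> trunc_tree d n"
      using tree_Aut_in[OF pin[OF gh(2)] v] v by (simp add: tree_proj_apply)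
    then show "tree_proj d n (g \<otimes>\<^bsub>Aut_T d\<^esub> h) v =
        (tree_proj d n g \<otimes>\<^bsub>Aut_Tn d n\<^esub> tree_proj d n h) v"
      using v gh pin by (simp add: tree_proj_apply tree_Aut_mult_apply trunc_tree_subset)
  qed (use gh pin in simp_all)
qed

lemma tree_proj_mult:
  "g \<in> carrier (Aut_T d) \<Longrightarrow> h \<in> carrier (Aut_T d) \<Longrightarrow>
    tree_proj d n (g \<otimes>\<^bsub>Aut_T d\<^esub> h) = tree_proj d n g \<otimes>\<^bsub>Aut_Tn d n\<^esub> tree_proj d n h"
  using tree_proj_hom by (rule hom_mult)

lemma tree_proj_inv:
  assumes "g \<in> carrier (Aut_T d)"
  shows "tree_proj d n (inv\<^bsub>Aut_T d\<^esub> g) = inv\<^bsub>Aut_Tn d n\<^esub> (tree_proj d n g)"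
proof -
  interpret group_hom "Aut_T d" "Aut_Tn d n" "tree_proj d n"
    by (intro group_hom.intro group_Aut_T group_Aut_Tn group_hom_axioms.intro tree_proj_hom)
  show ?thesis
    using assms by (rule hom_inv)
qed

text \<open>Deleting the first letter of a word of length at most \<open>D\<close> leaves one of
  length at most \<open>D - 1\<close>, so both sides are the same section restricted to that depth.
  All arrows of the converse direction come from here.\<close>

lemma section_arrow_tree_proj:
  assumes x: "x \<in> {1..d}" and D: "1 \<le> D"
  shows "section_arrow d D (tree_proj d D g) [x] (tree_proj d D (sect d g [x]))"
proof -
  have "{w. [x] @ w \<in> trunc_tree d D} = trunc_tree d (D - 1)"
    using x D by (auto simp: trunc_tree_def)
  moreover have "[x] \<in> trunc_tree d D"
    using x D by (simp add: trunc_tree_def)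
  ultimately show ?thesis
    using x by (auto simp: section_arrow_def tree_section_def tree_proj_def fun_eq_iff restrict_def
        trunc_tree_def)
qed

section \<open>Gluing local data into an automorphism\<close>

text \<open>The second argument is the word still to be read, the third the prefix already read,
  whose label moves the next letter. Only values of labels on one-letter words enter:
  \<open>r\<close> is used as a portrait.\<close>

primrec glue :: "(nat list \<Rightarrow> nat list \<Rightarrow> nat list) \<Rightarrow> nat list \<Rightarrow> nat list \<Rightarrow> nat list" where
  "glue r [] v = []"
| "glue r (x # w) v = r v [x] @ glue r w (v @ [x])"

lemma glue_append: "glue r (u @ w) v = glue r u v @ glue r w (v @ u)"
  by (induction u arbitrary: v) auto

context
  fixes d D :: nat and r :: "nat list \<Rightarrow> nat list \<Rightarrow> nat list"
  assumes D: "1 \<le> D"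
    and r: "\<And>v. v \<in> tree d \<Longrightarrow> r v \<in> carrier (Aut_Tn d D)"
    and compat: "\<And>v x. v \<in> tree d \<Longrightarrow> x \<in> {1..d} \<Longrightarrow> section_arrow d D (r v) [x] (r (v @ [x]))"
begin

text \<open>This and the next two lemmas say that each label permutes the first level, which lies
  inside the truncated tree because \<open>D\<close> is positive. Bijectivity of the glued map then
  follows letter by letter.\<close>

lemma glue_letter:
  assumes "v \<in> tree d" "x \<in> {1..d}"
  shows "\<exists>y\<in>{1..d}. r v [x] = [y]"
proof -
  have x: "[x] \<in> trunc_tree d D"
    using assms D by (simp add: trunc_tree_def)
  have "r v [x] \<in> tree d" "length (r v [x]) = 1"
    using tree_Aut_in[OF r[OF assms(1)] x] tree_Aut_length[OF _ r[OF assms(1)] x]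
    by (auto simp: trunc_tree_subset)
  then show ?thesis
    by (auto simp: length_Suc_conv)
qed

lemma glue_letter_inj:
  assumes "v \<in> tree d" "x \<in> {1..d}" "y \<in> {1..d}" "r v [x] = r v [y]"
  shows "x = y"
proof -
  have "inj_on (r v) (trunc_tree d D)"
    using r[OF assms(1)] by (simp add: tree_Aut_def Bij_def bij_betw_def)
  moreover have "[x] \<in> trunc_tree d D" "[y] \<in> trunc_tree d D"
    using assms D by (simp_all add: trunc_tree_def)
  ultimately show ?thesis
    using assms(4) by (auto dest: inj_onD)
qed

lemma glue_letter_surj:
  assumes "v \<in> tree d" "y \<in> {1..d}"
  shows "\<exists>x\<in>{1..d}. r v [x] = [y]"
proof -
  have y: "[y] \<in> trunc_tree d D"
    using assms D by (simp add: trunc_tree_def)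
  then have "[y] \<in> r v ` trunc_tree d D"
    using r[OF assms(1)] by (simp add: tree_Aut_def Bij_def bij_betw_def)
  then obtain w where w: "w \<in> trunc_tree d D" "r v w = [y]"
    by auto
  then have "length w = 1"
    using tree_Aut_length[OF _ r[OF assms(1)] w(1)] by simp
  then show ?thesis
    using w by (auto simp: length_Suc_conv trunc_tree_def)
qed

lemma glue_in_tree: "v \<in> tree d \<Longrightarrow> w \<in> tree d \<Longrightarrow> glue r w v \<in> tree d"
  by (induction w arbitrary: v) (use glue_letter in \<open>force+\<close>)

lemma length_glue: "v \<in> tree d \<Longrightarrow> w \<in> tree d \<Longrightarrow> length (glue r w v) = length w"
  by (induction w arbitrary: v) (use glue_letter in \<open>force+\<close>)

lemma glue_inj:
  "v \<in> tree d \<Longrightarrow> w \<in> tree d \<Longrightarrow> w' \<in> tree d \<Longrightarrow> glue r w v = glue r w' v \<Longrightarrow> w = w'"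
proof (induction w arbitrary: v w')
  case Nil
  then show ?case
    using length_glue[of v w'] by simp
next
  case (Cons x w)
  have "length w' = Suc (length w)"
    using Cons.prems length_glue[of v w'] length_glue[of v "x # w"] by simp
  then obtain y u where u: "w' = y # u"
    by (auto simp: length_Suc_conv)
  obtain a b where "r v [x] = [a]" "r v [y] = [b]"
    using glue_letter Cons.prems u by (metis Cons_in_tree)
  then have "r v [x] = r v [y]" and tl: "glue r w (v @ [x]) = glue r u (v @ [y])"
    using Cons.prems u by auto
  then have "x = y"
    using glue_letter_inj Cons.prems u by simp
  with tl u show ?case
    using Cons.IH[of "v @ [x]" u] Cons.prems by simp
qed

lemma glue_surj: "v \<in> tree d \<Longrightarrow> u \<in> tree d \<Longrightarrow> \<exists>w\<in>tree d. glue r w v = u"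
proof (induction u arbitrary: v)
  case Nil
  show ?case
    by (intro bexI[of _ "[]"]) simp_all
next
  case (Cons y u)
  then obtain x where x: "x \<in> {1..d}" "r v [x] = [y]"
    using glue_letter_surj[of v y] by auto
  with Cons obtain w where "w \<in> tree d" "glue r w (v @ [x]) = u"
    by (metis Cons_in_tree Nil_in_tree append_in_tree)
  with x show ?case
    by (intro bexI[of _ "x # w"]) simp_all
qed

definition glued :: "nat list \<Rightarrow> nat list" where
  "glued = (\<lambda>w\<in>tree d. glue r w [])"

lemma glued_in_Aut: "glued \<in> carrier (Aut_T d)"
proof -
  have "glued ` tree d = tree d"
    using glue_in_tree[of "[]"] glue_surj[of "[]"] by (auto simp: glued_def image_iff)
  moreover have "inj_on glued (tree d)"
    using glue_inj[of "[]"] by (auto simp: glued_def inj_on_def)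
  ultimately have "glued \<in> Bij (tree d)"
    by (simp add: Bij_def bij_betw_def glued_def)
  moreover have "glued (butlast w) = butlast (glued w)" if w: "w \<in> tree d" for w
  proof (cases w rule: rev_cases)
    \<comment> \<open>By \<open>glue_append\<close>, the last input letter contributes exactly the
      last output letter, so deleting one deletes the other.\<close>
    case (snoc u x)
    then have "length (r u [x]) = 1"
      using glue_letter[of u x] w by auto
    then show ?thesis
      using w snoc by (auto simp: glued_def glue_append butlast_append length_Suc_conv)
  qed (simp add: glued_def)
  ultimately show ?thesis
    using length_glue[of "[]"] by (simp add: tree_Aut_iff glued_def)
qed

text \<open>Gluing reads just the first letter from \<open>r v\<close> and then passes to the label
  of the child. The arrows say that this child label continues as the section of \<open>r v\<close>
  does, so all of \<open>r v\<close> is recovered.\<close>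

lemma glue_eq:
  "v \<in> tree d \<Longrightarrow> w \<in> trunc_tree d D \<Longrightarrow> glue r w v = r v w"
proof (induction w arbitrary: v)
  case Nil
  then show ?case
    using r[of v] by (simp add: tree_Aut_def)
next
  case (Cons x w)
  \<comment> \<open>The tail must lie in the smaller truncation for the arrow to speak about it, and
    in the larger one for the induction hypothesis.\<close>
  then have x: "x \<in> {1..d}" "w \<in> trunc_tree d (D - 1)" "w \<in> trunc_tree d D"
    by (auto simp: trunc_tree_def)
  have "r v ([x] @ w) = r v [x] @ tree_section (trunc_tree d D) (r v) [x] w"
    using Cons.prems by (intro tree_Aut_append r) auto
  also have "tree_section (trunc_tree d D) (r v) [x] w = r (v @ [x]) w"
    using compat[OF Cons.prems(1) x(1)] x(2) by (simp add: section_arrow_def tree_proj_apply)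
  finally show ?case
    using Cons x by simp
qed

text \<open>By \<open>glue_append\<close>, the section at \<open>v\<close> is gluing started with
  prefix \<open>v\<close>, and up to depth \<open>D\<close> this is the label by
  \<open>glue_eq\<close>.\<close>

lemma tree_proj_sect_glued:
  assumes v: "v \<in> tree d"
  shows "tree_proj d D (sect d glued v) = r v"
proof (rule tree_Aut_ext)
  show "tree_proj d D (sect d glued v) \<in> carrier (Aut_Tn d D)"
    using glued_in_Aut v by (intro tree_proj_in_Aut sect_in_Aut)
  show "r v \<in> carrier (Aut_Tn d D)"
    using r v .
  fix w assume w: "w \<in> trunc_tree d D"
  have "glued (v @ w) = glued v @ glue r w v"
    using v w by (simp add: glued_def glue_append trunc_tree_subset)
  then show "tree_proj d D (sect d glued v) w = r v w"
    using Aut_T_append[OF glued_in_Aut v, of w] w v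
    by (simp add: tree_proj_apply trunc_tree_subset glue_eq)
qed

end

section \<open>Groups of finite type and the conjugator graph\<close>

lemma conj_set_eq: "r <#\<^bsub>M\<^esub> H #>\<^bsub>M\<^esub> inv\<^bsub>M\<^esub> r = (\<lambda>p. r \<otimes>\<^bsub>M\<^esub> p \<otimes>\<^bsub>M\<^esub> inv\<^bsub>M\<^esub> r) ` H"
  by (auto simp: l_coset_def r_coset_def)

lemma (in group) conj_inv_conj:
  assumes "h \<in> carrier G" "g \<in> carrier G"
  shows "h \<otimes> (inv h \<otimes> g \<otimes> h) \<otimes> inv h = g" "inv h \<otimes> (h \<otimes> g \<otimes> inv h) \<otimes> h = g"
  using assms by (simp_all add: m_assoc) (simp_all add: m_assoc[symmetric])

lemma finite_type_group_subset: "finite_type_group d D P \<subseteq> carrier (Aut_T d)"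
  by (auto simp: finite_type_group_def)

lemma proj_in_pattern:
  "g \<in> finite_type_group d D P \<Longrightarrow> v \<in> tree d \<Longrightarrow> tree_proj d D (sect d g v) \<in> P"
  by (simp add: finite_type_group_def)

text \<open>The section is taken at \<open>h u\<close> so that \<open>inv h\<close> first leads back
  to \<open>u\<close>; every vertex has this form.\<close>

lemma sect_conj:
  assumes h: "h \<in> carrier (Aut_T d)" and g: "g \<in> carrier (Aut_T d)" and u: "u \<in> tree d"
  shows "sect d (h \<otimes>\<^bsub>Aut_T d\<^esub> g \<otimes>\<^bsub>Aut_T d\<^esub> inv\<^bsub>Aut_T d\<^esub> h) (h u) =
    sect d h (g u) \<otimes>\<^bsub>Aut_T d\<^esub> sect d g u \<otimes>\<^bsub>Aut_T d\<^esub> inv\<^bsub>Aut_T d\<^esub> (sect d h u)"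
proof -
  interpret group "Aut_T d" by (rule group_Aut_T)
  have "h u \<in> tree d"
    using h u by (rule tree_Aut_in)
  then show ?thesis
    using assms by (simp add: sect_mult sect_inv tree_Aut_inv_apply)
qed

text \<open>The two products differ by the left factor \<open>r' \<otimes> inv r\<close> from
  \<open>Q\<close>. This allows the label of \<open>h\<close> at \<open>g u\<close> to be replaced
  by the equivalent label at \<open>u\<close>, turning a twisted product into a genuine
  conjugate.\<close>

lemma (in group) conjugate_by_class_preserves:
  assumes Q: "subgroup Q G" and r: "r \<in> carrier G" "r' \<in> carrier G" and rr: "r' \<otimes> inv r \<in> Q"
    and p: "p \<in> carrier G"
  shows "r' \<otimes> p \<otimes> inv r \<in> Q \<longleftrightarrow> r \<otimes> p \<otimes> inv r \<in> Q"
proof -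
  have eq: "r' \<otimes> p \<otimes> inv r = (r' \<otimes> inv r) \<otimes> (r \<otimes> p \<otimes> inv r)"
    using r p by (simp add: m_assoc) (simp add: m_assoc[symmetric])
  have "inv (r' \<otimes> inv r) \<otimes> (r' \<otimes> p \<otimes> inv r) = r \<otimes> p \<otimes> inv r"
    using r p by (simp add: eq m_assoc[symmetric] inv_mult_group) (simp add: m_assoc)
  then show ?thesis
    using eq rr Q by (metis subgroup.m_closed subgroup.m_inv_closed)
qed

lemma (in group) conj_mem_iff:
  assumes "r \<in> carrier G" "P \<subseteq> carrier G" "p \<in> carrier G" and Q: "r <# P #> inv r = Q"
  shows "r \<otimes> p \<otimes> inv r \<in> Q \<longleftrightarrow> p \<in> P"
proof
  assume "r \<otimes> p \<otimes> inv r \<in> Q"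
  then obtain p' where "p' \<in> P" "r \<otimes> p \<otimes> inv r = r \<otimes> p' \<otimes> inv r"
    using Q by (auto simp: conj_set_eq)
  moreover have "p' \<in> carrier G"
    using calculation assms by blast
  ultimately show "p \<in> P"
    using assms by simp
qed (use Q in \<open>auto simp: conj_set_eq\<close>)

lemma conjugate_finite_type_groups:
  assumes P: "subgroup P (Aut_Tn d D)" and Q: "subgroup Q (Aut_Tn d D)"
    and h: "h \<in> carrier (Aut_T d)"
    and r: "\<And>v. v \<in> tree d \<Longrightarrow> tree_proj d D (sect d h v) \<in> conjugators d D P Q"
    and level: "\<And>u v. u \<in> tree d \<Longrightarrow> v \<in> tree d \<Longrightarrow> length u = length v \<Longrightarrow>
      (tree_proj d D (sect d h u), tree_proj d D (sect d h v)) \<in> conjugator_rel d D P Q"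
  shows "conjugate_in (Aut_T d) (finite_type_group d D P) (finite_type_group d D Q)"
proof -
  interpret T: group "Aut_T d" by (rule group_Aut_T)
  interpret Tn: group "Aut_Tn d D" by (rule group_Aut_Tn)
  have iff: "h \<otimes>\<^bsub>Aut_T d\<^esub> g \<otimes>\<^bsub>Aut_T d\<^esub> inv\<^bsub>Aut_T d\<^esub> h \<in> finite_type_group d D Q \<longleftrightarrow>
      g \<in> finite_type_group d D P" if g: "g \<in> carrier (Aut_T d)" for g
  proof -
    let ?c = "h \<otimes>\<^bsub>Aut_T d\<^esub> g \<otimes>\<^bsub>Aut_T d\<^esub> inv\<^bsub>Aut_T d\<^esub> h"
    have "tree_proj d D (sect d ?c (h u)) \<in> Q \<longleftrightarrow> tree_proj d D (sect d g u) \<in> P"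
      if u: "u \<in> tree d" for u
    proof -
      have gu: "g u \<in> tree d" "length (g u) = length u"
        using g u by (auto intro: tree_Aut_in tree_Aut_length[OF prefix_closed_tree])
      define a b p where "a = tree_proj d D (sect d h u)"
        and "b = tree_proj d D (sect d h (g u))" and "p = tree_proj d D (sect d g u)"
      have "tree_proj d D (sect d ?c (h u)) = b \<otimes>\<^bsub>Aut_Tn d D\<^esub> p \<otimes>\<^bsub>Aut_Tn d D\<^esub> inv\<^bsub>Aut_Tn d D\<^esub> a"
        using g h u gu
        by (simp add: a_def b_def p_def sect_conj tree_proj_mult tree_proj_inv sect_in_Aut)
      moreover have "a \<in> carrier (Aut_Tn d D)" "b \<in> carrier (Aut_Tn d D)" "p \<in> carrier (Aut_Tn d D)"
        using g h u gu by (simp_all add: a_def b_def p_def sect_in_Aut tree_proj_in_Aut)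
      \<comment> \<open>Since \<open>g\<close> preserves levels, the labels of \<open>h\<close> at
        \<open>u\<close> and at \<open>g u\<close> belong to one class.\<close>
      moreover have "b \<otimes>\<^bsub>Aut_Tn d D\<^esub> inv\<^bsub>Aut_Tn d D\<^esub> a \<in> Q"
        using level[OF gu(1) u gu(2)] by (simp add: conjugator_rel_def a_def b_def)
      moreover have "a <#\<^bsub>Aut_Tn d D\<^esub> P #>\<^bsub>Aut_Tn d D\<^esub> inv\<^bsub>Aut_Tn d D\<^esub> a = Q"
        using r[OF u] by (simp add: conjugators_def a_def)
      ultimately show ?thesis
        using Tn.conjugate_by_class_preserves[OF Q, of a b p] Tn.conj_mem_iff[of a P p Q]
          subgroup.subset[OF P] by (simp add: p_def)
    qed
    \<comment> \<open>The vertices \<open>h u\<close> exhaust the tree, so the local equivalence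
      decides membership in the whole group.\<close>
    moreover have "h ` tree d = tree d"
      using h by (simp add: tree_Aut_def Bij_def bij_betw_def)
    then have "(\<forall>v\<in>tree d. tree_proj d D (sect d ?c v) \<in> Q) \<longleftrightarrow>
        (\<forall>u\<in>tree d. tree_proj d D (sect d ?c (h u)) \<in> Q)"
      by (metis (no_types, lifting) image_iff)
    ultimately show ?thesis
      using g h by (simp add: finite_type_group_def)
  qed
  have "(\<lambda>g. h \<otimes>\<^bsub>Aut_T d\<^esub> g \<otimes>\<^bsub>Aut_T d\<^esub> inv\<^bsub>Aut_T d\<^esub> h) ` finite_type_group d D P =
      finite_type_group d D Q"
  proof (intro equalityI subsetI)
    fix g assume "g \<in> (\<lambda>g. h \<otimes>\<^bsub>Aut_T d\<^esub> g \<otimes>\<^bsub>Aut_T d\<^esub> inv\<^bsub>Aut_T d\<^esub> h) ` finite_type_group d D P"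
    then show "g \<in> finite_type_group d D Q"
      using iff finite_type_group_subset by blast
  next
    fix g assume g: "g \<in> finite_type_group d D Q"
    then have gc: "g \<in> carrier (Aut_T d)"
      using finite_type_group_subset by blast
    let ?g = "inv\<^bsub>Aut_T d\<^esub> h \<otimes>\<^bsub>Aut_T d\<^esub> g \<otimes>\<^bsub>Aut_T d\<^esub> h"
    have eq: "h \<otimes>\<^bsub>Aut_T d\<^esub> ?g \<otimes>\<^bsub>Aut_T d\<^esub> inv\<^bsub>Aut_T d\<^esub> h = g"
      using h gc by (rule T.conj_inv_conj)
    then have "?g \<in> finite_type_group d D P"
      using iff[of ?g] h g gc by simp
    with eq show "g \<in> (\<lambda>g. h \<otimes>\<^bsub>Aut_T d\<^esub> g \<otimes>\<^bsub>Aut_T d\<^esub> inv\<^bsub>Aut_T d\<^esub> h) ` finite_type_group d D P"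
      by (metis (no_types, lifting) imageI)
  qed
  with h show ?thesis
    by (auto simp: conjugate_in_def conj_set_eq)
qed

section \<open>The conjugator graph and infinite walks\<close>

lemma equiv_conjugator_rel:
  assumes Q: "subgroup Q (Aut_Tn d D)"
  shows "equiv (conjugators d D P Q) (conjugator_rel d D P Q)"
proof -
  interpret Tn: group "Aut_Tn d D" by (rule group_Aut_Tn)
  have S: "conjugators d D P Q \<subseteq> carrier (Aut_Tn d D)"
    by (auto simp: conjugators_def)
  have sym: "b \<otimes>\<^bsub>Aut_Tn d D\<^esub> inv\<^bsub>Aut_Tn d D\<^esub> a \<in> Q"
    if "a \<in> conjugators d D P Q" "b \<in> conjugators d D P Q"
      "a \<otimes>\<^bsub>Aut_Tn d D\<^esub> inv\<^bsub>Aut_Tn d D\<^esub> b \<in> Q" for a b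
  proof -
    have ab: "a \<in> carrier (Aut_Tn d D)" "b \<in> carrier (Aut_Tn d D)"
      using that S by auto
    have "inv\<^bsub>Aut_Tn d D\<^esub> (a \<otimes>\<^bsub>Aut_Tn d D\<^esub> inv\<^bsub>Aut_Tn d D\<^esub> b) \<in> Q"
      using Q that(3) by (rule subgroup.m_inv_closed)
    with ab show ?thesis
      by (simp add: Tn.inv_mult_group)
  qed
  have trans: "a \<otimes>\<^bsub>Aut_Tn d D\<^esub> inv\<^bsub>Aut_Tn d D\<^esub> c \<in> Q"
    if "a \<in> conjugators d D P Q" "b \<in> conjugators d D P Q" "c \<in> conjugators d D P Q"
      "a \<otimes>\<^bsub>Aut_Tn d D\<^esub> inv\<^bsub>Aut_Tn d D\<^esub> b \<in> Q" "b \<otimes>\<^bsub>Aut_Tn d D\<^esub> inv\<^bsub>Aut_Tn d D\<^esub> c \<in> Q" for a b c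
  proof -
    have abc: "a \<in> carrier (Aut_Tn d D)" "b \<in> carrier (Aut_Tn d D)" "c \<in> carrier (Aut_Tn d D)"
      using that S by auto
    have "(a \<otimes>\<^bsub>Aut_Tn d D\<^esub> inv\<^bsub>Aut_Tn d D\<^esub> b) \<otimes>\<^bsub>Aut_Tn d D\<^esub> (b \<otimes>\<^bsub>Aut_Tn d D\<^esub> inv\<^bsub>Aut_Tn d D\<^esub> c) \<in> Q"
      using Q that(4,5) by (rule subgroup.m_closed)
    with abc show ?thesis
      by (simp add: Tn.m_assoc) (simp add: Tn.m_assoc[symmetric])
  qed
  show ?thesis
  proof (rule equivI)
    show "conjugator_rel d D P Q \<subseteq> conjugators d D P Q \<times> conjugators d D P Q"
      by (auto simp: conjugator_rel_def)
    show "refl_on (conjugators d D P Q) (conjugator_rel d D P Q)"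
      using S subgroup.one_closed[OF Q] by (auto simp: refl_on_def conjugator_rel_def subset_iff)
    show "sym (conjugator_rel d D P Q)"
      using sym by (auto simp: sym_def conjugator_rel_def)
    show "trans (conjugator_rel d D P Q)"
      unfolding trans_def conjugator_rel_def using trans by blast
  qed
qed

lemma conjugator_graph_simps:
  "verts (conjugator_graph d D P Q) = conjugators d D P Q // conjugator_rel d D P Q"
  "tail (conjugator_graph d D P Q) = fst" "head (conjugator_graph d D P Q) = snd"
  "(C, C') \<in> arcs (conjugator_graph d D P Q) \<longleftrightarrow>
    C \<in> conjugators d D P Q // conjugator_rel d D P Q \<and>
    C' \<in> conjugators d D P Q // conjugator_rel d D P Q \<and>
    (\<forall>r\<in>C. \<exists>\<rho>. \<forall>x\<in>tree_level d 1. \<rho> x \<in> C' \<and> section_arrow d D r x (\<rho> x))"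
  by (simp_all add: conjugator_graph_def Let_def)

lemma wf_conjugator_graph: "wf_digraph (conjugator_graph d D P Q)"
  by standard (auto simp: conjugator_graph_def Let_def)

lemma finite_verts_conjugator_graph: "finite (verts (conjugator_graph d D P Q))"
proof -
  have "conjugators d D P Q \<subseteq> carrier (Aut_Tn d D)"
    by (auto simp: conjugators_def)
  then have "finite (conjugators d D P Q)"
    using finite_Aut_Tn by (rule finite_subset)
  then show ?thesis
    unfolding conjugator_graph_simps
    by (rule finite_quotient) (auto simp: conjugator_rel_def)
qed

text \<open>In a nonempty closed walk every arc has a successor within the walk, the last arc being
  followed by the first. Iterating a choice of successor gives the infinite walk.\<close>

lemma (in pre_digraph) cycle_imp_infinite_walk:
  assumes "cycle p"
  shows "\<exists>e. \<forall>n::nat. e n \<in> arcs G \<and> head G (e n) = tail G (e (Suc n))"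
proof -
  obtain u where u: "awalk u p u" "p \<noteq> []"
    using assms by (auto simp: cycle_def)
  have cas_step: "head G a = w \<or> (\<exists>b\<in>set q. tail G b = head G a)"
    if "cas v q w" "a \<in> set q" for a q v w
    using that
  proof (induction q arbitrary: v)
    case (Cons c q)
    then show ?case
      by (cases q) auto
  qed simp
  have "tail G (hd p) = u"
    using u by (cases p) (auto simp: awalk_def)
  then have "\<exists>b\<in>set p. tail G b = head G a" if "a \<in> set p" for a
    using cas_step[of u p u a] u that hd_in_set[OF u(2)] by (auto simp: awalk_def)
  then obtain f where f: "\<And>a. a \<in> set p \<Longrightarrow> f a \<in> set p \<and> tail G (f a) = head G a"
    by metis
  have "(f ^^ n) (hd p) \<in> set p" for n
    by (induction n) (use u f in auto)
  then show ?thesis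
    using f u by (intro exI[of _ "\<lambda>n. (f ^^ n) (hd p)"]) (auto simp: awalk_def)
qed

text \<open>Among finitely many vertices some tail repeats; the segment between two visits is a
  nonempty closed walk, from which a cycle is extracted.\<close>

lemma (in wf_digraph) infinite_walk_imp_cycle:
  fixes e :: "nat \<Rightarrow> 'b"
  assumes "finite (verts G)" and e: "\<And>n. e n \<in> arcs G" "\<And>n. head G (e n) = tail G (e (Suc n))"
  shows "\<exists>p. cycle p"
proof -
  have "range (\<lambda>n. tail G (e n)) \<subseteq> verts G"
    using e by auto
  then have "\<not> inj (\<lambda>n. tail G (e n))"
    using assms(1) finite_subset finite_imageD infinite_UNIV_nat by metis
  then obtain i j where ij: "i < j" "tail G (e i) = tail G (e j)"
    by (metis injI linorder_neqE_nat)
  \<comment> \<open>Stated for all starting points, because the induction on the length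
    \<open>k\<close> peels off the first arc.\<close>
  have "cas (tail G (e i)) (map e [i..<i + k]) (tail G (e (i + k)))" for i k
  proof (induction k arbitrary: i)
    case (Suc k)
    have "[i..<i + Suc k] = i # [Suc i..<Suc i + k]"
      by (simp add: upt_conv_Cons)
    then show ?case
      using Suc[of "Suc i"] e by simp
  qed simp
  from this[of i "j - i"] have "closed_w (map e [i..<j])"
    using ij e by (auto simp: closed_w_def awalk_def intro!: exI[of _ "tail G (e j)"])
  then show ?thesis
    by (rule closed_w_imp_cycle)
qed

section \<open>From a cycle to a conjugating automorphism\<close>

lemma has_cycle_imp_conjugate:
  assumes D: "1 \<le> D" and P: "subgroup P (Aut_Tn d D)" and Q: "subgroup Q (Aut_Tn d D)"
    and cyc: "has_cycle (conjugator_graph d D P Q)"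
  shows "conjugate_in (Aut_T d) (finite_type_group d D P) (finite_type_group d D Q)"
proof -
  let ?V = "conjugators d D P Q // conjugator_rel d D P Q"
  obtain p where "pre_digraph.cycle (conjugator_graph d D P Q) p"
    using cyc by (auto simp: has_cycle_def)
  then obtain e where e: "\<And>n::nat. e n \<in> arcs (conjugator_graph d D P Q)"
    "\<And>n. snd (e n) = fst (e (Suc n))"
    using pre_digraph.cycle_imp_infinite_walk conjugator_graph_simps(2,3) by metis
  define C where "C n = fst (e n)" for n
  have arc: "(C n, C (Suc n)) \<in> arcs (conjugator_graph d D P Q)" for n
    using e[of n] by (simp add: C_def) (metis prod.collapse)
  have CV: "C n \<in> ?V" for n
    using arc[of n] by (simp add: conjugator_graph_simps)
  have "\<forall>n. \<forall>r\<in>C n. \<exists>\<rho>. \<forall>x\<in>tree_level d 1. \<rho> x \<in> C (Suc n) \<and> section_arrow d D r x (\<rho> x)"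
    using arc by (simp add: conjugator_graph_simps)
  then obtain F where F: "\<And>n r x. r \<in> C n \<Longrightarrow> x \<in> tree_level d 1 \<Longrightarrow>
      F n r x \<in> C (Suc n) \<and> section_arrow d D r x (F n r x)"
    by metis
  obtain r0 where r0: "r0 \<in> C 0"
    using CV[of 0] in_quotient_imp_non_empty[OF equiv_conjugator_rel[OF Q]] by blast
  \<comment> \<open>Labels are chosen from the root downwards, so the recursion must add letters on
    the right; hence the reversed word. Here \<open>length w\<close> is the level of the parent,
    which selects the arc of the walk.\<close>
  define R where "R v = rec_list r0 (\<lambda>x w r. F (length w) r [x]) (rev v)" for v
  have R_simps: "R [] = r0" "R (v @ [x]) = F (length v) (R v) [x]" for v x
    by (simp_all add: R_def)
  have RC: "R v \<in> C (length v)" if "v \<in> tree d" for v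
    using that
  proof (induction v rule: rev_induct)
    case (snoc x v)
    then show ?case
      using F[of "R v" "length v" "[x]"] by (simp add: R_simps tree_level_def)
  qed (simp add: R_simps r0)
  have rel: "(a, b) \<in> conjugator_rel d D P Q" if "a \<in> C n" "b \<in> C n" for a b n
    using in_quotient_imp_in_rel[OF equiv_conjugator_rel[OF Q] CV[of n]] that by blast
  have CS: "C n \<subseteq> conjugators d D P Q" for n
    using in_quotient_imp_subset[OF equiv_conjugator_rel[OF Q] CV] .
  have R_Aut: "R v \<in> carrier (Aut_Tn d D)" if "v \<in> tree d" for v
    using RC[OF that] CS by (auto simp: conjugators_def)
  have R_compat: "section_arrow d D (R v) [x] (R (v @ [x]))" if "v \<in> tree d" "x \<in> {1..d}" for v x
    using F[OF RC[OF that(1)], of "[x]"] that by (simp add: R_simps tree_level_def)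
  have glue: "glued d R \<in> carrier (Aut_T d)"
    using D R_Aut R_compat by (rule glued_in_Aut)
  have proj: "tree_proj d D (sect d (glued d R) v) = R v" if "v \<in> tree d" for v
    using D R_Aut R_compat that by (rule tree_proj_sect_glued)
  have "R v \<in> conjugators d D P Q" if "v \<in> tree d" for v
    using RC[OF that] CS by blast
  moreover have "(R u, R v) \<in> conjugator_rel d D P Q"
    if "u \<in> tree d" "v \<in> tree d" "length u = length v" for u v
    using RC[OF that(1)] RC[OF that(2)] that(3) rel by simp
  ultimately show ?thesis
    by (intro conjugate_finite_type_groups[OF P Q glue]) (simp_all add: proj)
qed

text \<open>Conjugation by \<open>q\<close> maps \<open>Q\<close> onto itself, so
  \<open>q \<otimes> r\<close> still conjugates \<open>P\<close> to \<open>Q\<close>, and its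
  quotient by \<open>r\<close> is \<open>q\<close>.\<close>

lemma conjugators_mult:
  assumes P: "subgroup P (Aut_Tn d D)" and Q: "subgroup Q (Aut_Tn d D)"
    and r: "r \<in> conjugators d D P Q" and q: "q \<in> Q"
  shows "(q \<otimes>\<^bsub>Aut_Tn d D\<^esub> r, r) \<in> conjugator_rel d D P Q"
proof -
  interpret Tn: group "Aut_Tn d D" by (rule group_Aut_Tn)
  have rc: "r \<in> carrier (Aut_Tn d D)" and qc: "q \<in> carrier (Aut_Tn d D)"
    using r q subgroup.subset[OF Q] by (auto simp: conjugators_def)
  have "q \<otimes>\<^bsub>Aut_Tn d D\<^esub> r <#\<^bsub>Aut_Tn d D\<^esub> P #>\<^bsub>Aut_Tn d D\<^esub> inv\<^bsub>Aut_Tn d D\<^esub> (q \<otimes>\<^bsub>Aut_Tn d D\<^esub> r) =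
      (\<lambda>a. q \<otimes>\<^bsub>Aut_Tn d D\<^esub> a \<otimes>\<^bsub>Aut_Tn d D\<^esub> inv\<^bsub>Aut_Tn d D\<^esub> q) `
        (\<lambda>p. r \<otimes>\<^bsub>Aut_Tn d D\<^esub> p \<otimes>\<^bsub>Aut_Tn d D\<^esub> inv\<^bsub>Aut_Tn d D\<^esub> r) ` P"
    unfolding conj_set_eq image_image
    using rc qc subgroup.subset[OF P]
    by (intro image_cong) (auto simp: Tn.inv_mult_group Tn.m_assoc subset_iff)
  also have "(\<lambda>p. r \<otimes>\<^bsub>Aut_Tn d D\<^esub> p \<otimes>\<^bsub>Aut_Tn d D\<^esub> inv\<^bsub>Aut_Tn d D\<^esub> r) ` P = Q"
    using r by (simp add: conjugators_def conj_set_eq)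
  also have "(\<lambda>a. q \<otimes>\<^bsub>Aut_Tn d D\<^esub> a \<otimes>\<^bsub>Aut_Tn d D\<^esub> inv\<^bsub>Aut_Tn d D\<^esub> q) ` Q = Q"
  proof (intro equalityI subsetI)
    fix a assume "a \<in> (\<lambda>a. q \<otimes>\<^bsub>Aut_Tn d D\<^esub> a \<otimes>\<^bsub>Aut_Tn d D\<^esub> inv\<^bsub>Aut_Tn d D\<^esub> q) ` Q"
    then show "a \<in> Q"
      using q Q by (auto simp: subgroup.m_closed subgroup.m_inv_closed)
  next
    fix a assume a: "a \<in> Q"
    then have "a \<in> carrier (Aut_Tn d D)"
      using subgroup.subset[OF Q] by blast
    then have "q \<otimes>\<^bsub>Aut_Tn d D\<^esub> (inv\<^bsub>Aut_Tn d D\<^esub> q \<otimes>\<^bsub>Aut_Tn d D\<^esub> a \<otimes>\<^bsub>Aut_Tn d D\<^esub> q) \<otimes>\<^bsub>Aut_Tn d D\<^esub> inv\<^bsub>Aut_Tn d D\<^esub> q = a"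
      using qc by (intro Tn.conj_inv_conj)
    moreover have "inv\<^bsub>Aut_Tn d D\<^esub> q \<otimes>\<^bsub>Aut_Tn d D\<^esub> a \<otimes>\<^bsub>Aut_Tn d D\<^esub> q \<in> Q"
      using a q Q by (simp add: subgroup.m_closed subgroup.m_inv_closed)
    ultimately show "a \<in> (\<lambda>a. q \<otimes>\<^bsub>Aut_Tn d D\<^esub> a \<otimes>\<^bsub>Aut_Tn d D\<^esub> inv\<^bsub>Aut_Tn d D\<^esub> q) ` Q"
      by (metis (no_types, lifting) imageI)
  qed
  finally show ?thesis
    using r q rc qc by (simp add: conjugator_rel_def conjugators_def Tn.m_assoc)
qed

section \<open>From conjugacy of a fractal group to a cycle\<close>

lemma conjugate_imp_has_cycle:
  assumes d: "1 \<le> d" and D: "1 \<le> D"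
    and P: "minimal_pattern_subgroup d D P" and Q: "minimal_pattern_subgroup d D Q"
    and frac: "fractal d (finite_type_group d D P)"
    and conj: "conjugate_in (Aut_T d) (finite_type_group d D P) (finite_type_group d D Q)"
  shows "has_cycle (conjugator_graph d D P Q)"
proof -
  interpret T: group "Aut_T d" by (rule group_Aut_T)
  interpret Tn: group "Aut_Tn d D" by (rule group_Aut_Tn)
  let ?GP = "finite_type_group d D P" and ?GQ = "finite_type_group d D Q"
  let ?c = "\<lambda>r p. r \<otimes>\<^bsub>Aut_Tn d D\<^esub> p \<otimes>\<^bsub>Aut_Tn d D\<^esub> inv\<^bsub>Aut_Tn d D\<^esub> r"
  have sP: "subgroup P (Aut_Tn d D)" and sQ: "subgroup Q (Aut_Tn d D)"
    and PG: "tree_proj d D ` ?GP = P" and QG: "tree_proj d D ` ?GQ = Q"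
    using P Q by (auto simp: minimal_pattern_subgroup_def)
  have Pc: "P \<subseteq> carrier (Aut_Tn d D)" and Qc: "Q \<subseteq> carrier (Aut_Tn d D)"
    using sP sQ by (simp_all add: subgroup.subset)
  have GPc: "g \<in> carrier (Aut_T d)" if "g \<in> ?GP" for g
    using that finite_type_group_subset by blast
  obtain h where h: "h \<in> carrier (Aut_T d)"
    and hG: "(\<lambda>g. h \<otimes>\<^bsub>Aut_T d\<^esub> g \<otimes>\<^bsub>Aut_T d\<^esub> inv\<^bsub>Aut_T d\<^esub> h) ` ?GP = ?GQ"
    using conj by (auto simp: conjugate_in_def conj_set_eq)
  define r where "r v = tree_proj d D (sect d h v)" for v
  have rc: "r v \<in> carrier (Aut_Tn d D)" if "v \<in> tree d" for v
    using h that by (simp add: r_def sect_in_Aut tree_proj_in_Aut)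
  \<comment> \<open>This is the pattern of \<open>h g (inv h)\<close> at \<open>h v\<close>, an
    element of \<open>Q\<close> because the conjugate lies in \<open>?GQ\<close>.\<close>
  have transport: "r (g v) \<otimes>\<^bsub>Aut_Tn d D\<^esub> tree_proj d D (sect d g v) \<otimes>\<^bsub>Aut_Tn d D\<^esub> inv\<^bsub>Aut_Tn d D\<^esub> (r v) \<in> Q"
    if g: "g \<in> ?GP" and v: "v \<in> tree d" for g v
  proof -
    have gv: "g v \<in> tree d" and hv: "h v \<in> tree d"
      using GPc[OF g] h v by (auto intro: tree_Aut_in)
    have "tree_proj d D (sect d (h \<otimes>\<^bsub>Aut_T d\<^esub> g \<otimes>\<^bsub>Aut_T d\<^esub> inv\<^bsub>Aut_T d\<^esub> h) (h v)) \<in> Q"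
      using hG g hv by (intro proj_in_pattern) auto
    then show ?thesis
      using h v gv GPc[OF g]
      by (simp add: sect_conj r_def sect_in_Aut tree_proj_mult tree_proj_inv)
  qed
  have sub: "?c (r v) ` P \<subseteq> Q" if v: "v \<in> tree d" for v
  proof (intro image_subsetI)
    fix p assume "p \<in> P"
    \<comment> \<open>Minimality of \<open>P\<close> lifts the pattern \<open>p\<close> to the
      group; fractality then realises this lift as the section at \<open>v\<close> of an element
      fixing \<open>v\<close>, to which \<open>transport\<close> applies.\<close>
    then obtain g where g: "g \<in> ?GP" "p = tree_proj d D g"
      using PG by auto
    then have "g \<in> {sect d g v |g. g \<in> ?GP \<and> g v = v}"
      using frac v by (simp add: fractal_def)
    then obtain g' where "g' \<in> ?GP" "g' v = v" "g = sect d g' v"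
      by blast
    then show "?c (r v) p \<in> Q"
      using transport[of g' v] v g by simp
  qed
  have inj: "inj_on (?c (r v)) P" if "v \<in> tree d" for v
    using rc[OF that] Pc by (auto simp: inj_on_def subset_iff)
  \<comment> \<open>At the root the section is \<open>h\<close> itself, so minimality of
    \<open>Q\<close> gives the reverse inclusion directly. The resulting equality of cardinalities
    upgrades the inclusion \<open>sub\<close> at all other vertices.\<close>
  have "Q \<subseteq> ?c (r []) ` P"
  proof
    fix q assume "q \<in> Q"
    then obtain g where "g \<in> ?GP"
      "q = tree_proj d D (h \<otimes>\<^bsub>Aut_T d\<^esub> g \<otimes>\<^bsub>Aut_T d\<^esub> inv\<^bsub>Aut_T d\<^esub> h)"
      using QG hG by (metis (no_types, lifting) imageE)
    moreover from this have "tree_proj d D g \<in> P"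
      using PG by blast
    ultimately show "q \<in> ?c (r []) ` P"
      using h GPc by (auto simp: r_def sect_Nil tree_proj_mult tree_proj_inv)
  qed
  then have "?c (r []) ` P = Q"
    using sub[of "[]"] by auto
  then have card: "card Q = card P"
    using inj[of "[]"] card_image by fastforce
  have fin: "finite Q"
    using Qc finite_Aut_Tn by (rule finite_subset)
  have rS: "r v \<in> conjugators d D P Q" if v: "v \<in> tree d" for v
  proof -
    have "?c (r v) ` P = Q"
      using fin sub[OF v] by (rule card_subset_eq) (simp add: card card_image[OF inj[OF v]])
    then show ?thesis
      using rc[OF v] by (simp add: conjugators_def conj_set_eq)
  qed
  have level: "(r u, r v) \<in> conjugator_rel d D P Q"
    if uv: "u \<in> tree d" "v \<in> tree d" "length u = length v" for u v
  proof -
    obtain g where g: "g \<in> ?GP" "g v = u"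
      using frac uv by (auto simp: fractal_def level_transitive_def tree_level_def)
    let ?p = "tree_proj d D (sect d g v)"
    have p: "?p \<in> P"
      using g uv by (intro proj_in_pattern)
    let ?q = "r u \<otimes>\<^bsub>Aut_Tn d D\<^esub> ?p \<otimes>\<^bsub>Aut_Tn d D\<^esub> inv\<^bsub>Aut_Tn d D\<^esub> (r v)"
    have "?q \<in> Q"
      using transport[OF g(1) uv(2)] g(2) by simp
    \<comment> \<open>Multiplying by this conjugate of \<open>inv ?p\<close> cancels
      \<open>?p\<close> and \<open>r v\<close>, leaving the quotient of the two labels.\<close>
    moreover have "?c (r v) (inv\<^bsub>Aut_Tn d D\<^esub> ?p) \<in> Q"
      using sub[OF uv(2)] subgroup.m_inv_closed[OF sP p] by blast
    ultimately have "?q \<otimes>\<^bsub>Aut_Tn d D\<^esub> ?c (r v) (inv\<^bsub>Aut_Tn d D\<^esub> ?p) \<in> Q"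
      by (rule subgroup.m_closed[OF sQ])
    also have "?q \<otimes>\<^bsub>Aut_Tn d D\<^esub> ?c (r v) (inv\<^bsub>Aut_Tn d D\<^esub> ?p) = r u \<otimes>\<^bsub>Aut_Tn d D\<^esub> inv\<^bsub>Aut_Tn d D\<^esub> (r v)"
    proof -
      have car: "r u \<in> carrier (Aut_Tn d D)" "r v \<in> carrier (Aut_Tn d D)" "?p \<in> carrier (Aut_Tn d D)"
        using rc uv p Pc by auto
      have cancel: "inv\<^bsub>Aut_Tn d D\<^esub> a \<otimes>\<^bsub>Aut_Tn d D\<^esub> (a \<otimes>\<^bsub>Aut_Tn d D\<^esub> b) = b"
        "a \<otimes>\<^bsub>Aut_Tn d D\<^esub> (inv\<^bsub>Aut_Tn d D\<^esub> a \<otimes>\<^bsub>Aut_Tn d D\<^esub> b) = b"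
        if "a \<in> carrier (Aut_Tn d D)" "b \<in> carrier (Aut_Tn d D)" for a b
        using that by (simp_all add: Tn.m_assoc[symmetric])
      show ?thesis
        using car by (simp add: Tn.m_assoc cancel)
    qed
    finally show ?thesis
      using rS uv by (simp add: conjugator_rel_def)
  qed
  \<comment> \<open>A ray supplies one representative per level; by \<open>level\<close> the classes
    do not depend on the ray.\<close>
  define v where "v n = replicate n (1::nat)" for n
  have v: "v n \<in> tree d" "length (v n) = n" for n
    using d by (auto simp: v_def tree_def in_lists_conv_set)
  define C where "C n = conjugator_rel d D P Q `` {r (v n)}" for n
  note equiv = equiv_conjugator_rel[OF sQ, of P]
  have CV: "C n \<in> conjugators d D P Q // conjugator_rel d D P Q" for n
    unfolding C_def by (intro quotientI rS v)
  have arc: "(C n, C (Suc n)) \<in> arcs (conjugator_graph d D P Q)" for n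
  proof -
    have "\<exists>\<rho>. \<forall>x\<in>tree_level d 1. \<rho> x \<in> C (Suc n) \<and> section_arrow d D s x (\<rho> x)" if s: "s \<in> C n" for s
    proof -
      have rel: "(s, r (v n)) \<in> conjugator_rel d D P Q"
        using s equiv by (auto simp: C_def dest: equivE intro: symD)
      then have sc: "s \<in> carrier (Aut_Tn d D)"
        and "s \<otimes>\<^bsub>Aut_Tn d D\<^esub> inv\<^bsub>Aut_Tn d D\<^esub> (r (v n)) \<in> Q"
        by (auto simp: conjugator_rel_def conjugators_def)
      \<comment> \<open>An arc concerns every member \<open>s\<close> of the class. Minimality of
        \<open>Q\<close> lifts the discrepancy between \<open>s\<close> and \<open>r (v n)\<close>
        to \<open>?GQ\<close>, which exhibits \<open>s\<close> as the truncation of a full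
        automorphism.\<close>
      then obtain g where g: "g \<in> ?GQ" "s \<otimes>\<^bsub>Aut_Tn d D\<^esub> inv\<^bsub>Aut_Tn d D\<^esub> (r (v n)) = tree_proj d D g"
        using QG by auto
      have gc: "g \<in> carrier (Aut_T d)"
        using g finite_type_group_subset by blast
      let ?h = "sect d h (v n)"
      have hc: "?h \<in> carrier (Aut_T d)"
        using h v by (simp add: sect_in_Aut)
      have "s = tree_proj d D g \<otimes>\<^bsub>Aut_Tn d D\<^esub> r (v n)"
        using g(2)[symmetric] sc rc v by (simp add: Tn.m_assoc)
      then have s_eq: "s = tree_proj d D (g \<otimes>\<^bsub>Aut_T d\<^esub> ?h)"
        using gc hc by (simp add: tree_proj_mult r_def)
      \<comment> \<open>The truncation \<open>s\<close> determines its sections only to depth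
        \<open>D - 1\<close>; those of the lifted automorphism provide the missing level.\<close>
      define \<rho> where "\<rho> x = tree_proj d D (sect d (g \<otimes>\<^bsub>Aut_T d\<^esub> ?h) x)" for x
      have "\<rho> [x] \<in> C (Suc n) \<and> section_arrow d D s [x] (\<rho> [x])" if x: "x \<in> {1..d}" for x
      proof
        have xt: "[x] \<in> tree d"
          using x by simp
        have hx: "?h [x] \<in> tree d"
          using hc xt by (rule tree_Aut_in)
        \<comment> \<open>By the product rule this differs from the label at
          \<open>v n @ [x]\<close> by a pattern of \<open>g\<close>, hence by an element of
          \<open>Q\<close>; \<open>level\<close> then moves to the vertex
          \<open>v (Suc n)\<close>.\<close>
        have "\<rho> [x] = tree_proj d D (sect d g (?h [x])) \<otimes>\<^bsub>Aut_Tn d D\<^esub> r (v n @ [x])"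
          using gc hc h hx xt v
          by (simp add: \<rho>_def sect_mult tree_proj_mult sect_in_Aut sect_sect r_def)
        moreover have "tree_proj d D (sect d g (?h [x])) \<in> Q"
          using g hx by (intro proj_in_pattern)
        ultimately have "(\<rho> [x], r (v n @ [x])) \<in> conjugator_rel d D P Q"
          using conjugators_mult[OF sP sQ rS] v xt by simp
        moreover have "(r (v n @ [x]), r (v (Suc n))) \<in> conjugator_rel d D P Q"
          using level v xt by simp
        ultimately show "\<rho> [x] \<in> C (Suc n)"
          using equiv unfolding C_def by (auto elim!: equivE dest: symD transD)
        show "section_arrow d D s [x] (\<rho> [x])"
          unfolding s_eq \<rho>_def using x D by (rule section_arrow_tree_proj)
      qed
      then show ?thesis
        by (intro exI[of _ \<rho>]) (auto simp: tree_level_def length_Suc_conv)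
    qed
    then show ?thesis
      using CV by (simp add: conjugator_graph_simps)
  qed
  interpret \<Gamma>: wf_digraph "conjugator_graph d D P Q"
    by (rule wf_conjugator_graph)
  have "\<exists>p. \<Gamma>.cycle p"
    by (rule \<Gamma>.infinite_walk_imp_cycle[of "\<lambda>n. (C n, C (Suc n))"])
      (use arc in \<open>auto simp: finite_verts_conjugator_graph conjugator_graph_simps(2,3)\<close>)
  then show ?thesis
    by (simp add: has_cycle_def)
qed

theorem theorem5:
  fixes d D :: nat and P Q :: "(nat list \<Rightarrow> nat list) set"
  assumes "2 \<le> d" and "1 \<le> D"
    and "minimal_pattern_subgroup d D P"
    and "minimal_pattern_subgroup d D Q"
  shows "(has_cycle (conjugator_graph d D P Q) \<longrightarrow>
           conjugate_in (Aut_T d) (finite_type_group d D P) (finite_type_group d D Q)) \<and>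
         (fractal d (finite_type_group d D P) \<longrightarrow>
           (conjugate_in (Aut_T d) (finite_type_group d D P) (finite_type_group d D Q) \<longleftrightarrow>
            has_cycle (conjugator_graph d D P Q)))"
proof -
  have "subgroup P (Aut_Tn d D)" "subgroup Q (Aut_Tn d D)"
    using assms(3,4) by (simp_all add: minimal_pattern_subgroup_def)
  then show ?thesis
    using assms has_cycle_imp_conjugate[of D P d Q] conjugate_imp_has_cycle[of d D P Q] by auto
qed

end
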